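(* Let $p\ge 0$ be an integer and let $f:\mathbb{R}\to\mathbb{R}$ be smooth. Then the pseudo-Riemannian manifold $\mathcal{M}_{2p+6,f}=(\mathbb{R}^{2p+6},g_{2p+6,f})$ defined in the context is Ricci flat, nilpotent Osserman, and nilpotent Ivanov-Petrova.
   Context: Manifold. Let $(x,y,z_0,\dots,z_p,\bar x,\bar y,\bar z_0,\dots,\bar z_p)$ be coordinates on $\mathbb{R}^{2p+6}$. For smooth $f=f(y)$ put $F_{2p+6,f}(y,\vec z)=f(y)+yz_0+y^2z_1+\dots+y^{p+1}z_p$. The metric $g_{2p+6,f}$, of neutral signature $(p+3,p+3)$, is the symmetric tensor whose only non-zero components (up to symmetry) are $g(\partial_{z_i},\partial_{\bar z_j})=\delta_{ij}$, $g(\partial_x,\partial_{\bar x})=1$, $g(\partial_y,\partial_{\bar y})=1$, $g(\partial_x,\partial_x)=-2F_{2p+6,f}(y,\vec z)$. Curvature. $\nabla$ is the Levi-Civita connection, $\mathcal{R}(X,Y)=\nabla_X\nabla_Y-\nabla_Y\nabla_X-\nabla_{[X,Y]}$, $R(X,Y,Z,W)=g(\mathcal{R}(X,Y)Z,W)$. The Jacobi operator $J(X)$ is the self-adjoint operator characterized by $g(J(X)Y,Z)=R(Y,X,X,Z)$. A pseudo-Riemannian manifold is nilpotent Osserman if $0$ is the only eigenvalue (complex eigenvalues being allowed, i.e. the operator is nilpotent) of $J(X)$ for every tangent vector $X$. If $\{e_1,e_2\}$ is an oriented orthonormal basis (i.e. $g(e_1,e_2)=0$, $g(e_i,e_i)=\pm1$)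 of a non-degenerate oriented $2$-plane $\pi$ in a tangent space, the skew-symmetric endomorphism $\mathcal{R}(\pi):=\mathcal{R}(e_1,e_2)$ is independent of the basis chosen. The manifold is nilpotent Ivanov-Petrova if $0$ is the only eigenvalue (complex eigenvalues being allowed) of $\mathcal{R}(\pi)$ for every such $\pi$. *)

theory Defs
  imports "HOL-Analysis.Analysis"
begin

section \<open>Smooth functions\<close>

primrec C_k :: "nat \<Rightarrow> ('a::real_normed_vector \<Rightarrow> 'b::real_normed_vector) \<Rightarrow> bool" where
  "C_k 0 f \<longleftrightarrow> continuous_on UNIV f"
| "C_k (Suc k) f \<longleftrightarrow> (\<forall>a. f differentiable (at a)) \<and>
     (\<forall>v. C_k k (\<lambda>a. frechet_derivative f (at a) v))"

definition smooth :: "('a::real_normed_vector \<Rightarrow> 'b::real_normed_vector) \<Rightarrow> bool" where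
  "smooth f \<longleftrightarrow> (\<forall>k. C_k k f)"


section \<open>Pseudo-Riemannian geometry on \<open>\<real>\<^sup>n\<close>\<close>

text \<open>
  The manifold is the whole of \<^typ>\<open>real^'n\<close> with its global chart, so every tangent space is
  identified with \<^typ>\<open>real^'n\<close>, the coordinate field of the index \<open>i\<close> being the constant
  field \<^term>\<open>axis i 1\<close>. A metric assigns to each point a bilinear form.
\<close>

type_synonym 'n vfield = "real^'n \<Rightarrow> real^'n"
type_synonym 'n metric = "real^'n \<Rightarrow> real^'n \<Rightarrow> real^'n \<Rightarrow> real"

definition pseudo_riemannian_metric :: "'n::finite metric \<Rightarrow> bool" where
  "pseudo_riemannian_metric g \<longleftrightarrow>
     (\<forall>a. bilinear (g a)) \<and>
     (\<forall>a u v. g a u v = g a v u) \<and>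
     (\<forall>a u. (\<forall>v. g a u v = 0) \<longrightarrow> u = 0) \<and>
     (\<forall>u v. smooth (\<lambda>a. g a u v))"

definition lie_derivative :: "'n::finite vfield \<Rightarrow> (real^'n \<Rightarrow> real) \<Rightarrow> real^'n \<Rightarrow> real" where
  "lie_derivative X \<phi> a = frechet_derivative \<phi> (at a) (X a)"

definition lie_bracket :: "'n::finite vfield \<Rightarrow> 'n vfield \<Rightarrow> 'n vfield" where
  "lie_bracket X Y a = frechet_derivative Y (at a) (X a) - frechet_derivative X (at a) (Y a)"

definition affine_connection :: "('n::finite vfield \<Rightarrow> 'n vfield \<Rightarrow> 'n vfield) \<Rightarrow> bool" where
  "affine_connection D \<longleftrightarrow>
     (\<forall>X Y. smooth X \<longrightarrow> smooth Y \<longrightarrow> smooth (D X Y)) \<and>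
     (\<forall>X X' Y a. smooth X \<longrightarrow> smooth X' \<longrightarrow> smooth Y \<longrightarrow>
        D (\<lambda>b. X b + X' b) Y a = D X Y a + D X' Y a) \<and>
     (\<forall>\<phi> X Y a. smooth \<phi> \<longrightarrow> smooth X \<longrightarrow> smooth Y \<longrightarrow>
        D (\<lambda>b. \<phi> b *\<^sub>R X b) Y a = \<phi> a *\<^sub>R D X Y a) \<and>
     (\<forall>X Y Y' a. smooth X \<longrightarrow> smooth Y \<longrightarrow> smooth Y' \<longrightarrow>
        D X (\<lambda>b. Y b + Y' b) a = D X Y a + D X Y' a) \<and>
     (\<forall>\<phi> X Y a. smooth \<phi> \<longrightarrow> smooth X \<longrightarrow> smooth Y \<longrightarrow>
        D X (\<lambda>b. \<phi> b *\<^sub>R Y b) a = lie_derivative X \<phi> a *\<^sub>R Y a + \<phi> a *\<^sub>R D X Y a)"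

definition levi_civita_connection ::
    "'n::finite metric \<Rightarrow> ('n vfield \<Rightarrow> 'n vfield \<Rightarrow> 'n vfield) \<Rightarrow> bool" where
  "levi_civita_connection g D \<longleftrightarrow>
     affine_connection D \<and>
     (\<forall>X Y a. smooth X \<longrightarrow> smooth Y \<longrightarrow> D X Y a - D Y X a = lie_bracket X Y a) \<and>
     (\<forall>X Y Z a. smooth X \<longrightarrow> smooth Y \<longrightarrow> smooth Z \<longrightarrow>
        lie_derivative X (\<lambda>b. g b (Y b) (Z b)) a = g a (D X Y a) (Z a) + g a (Y a) (D X Z a))"

text \<open>
  The Levi-Civita connection is unique on smooth vector fields; its values on non-smooth ones
  are arbitrary and never used below. This is why the choice operator appears, and not \<open>THE\<close>.
\<close>

definition levi_civita :: "'n::finite metric \<Rightarrow> 'n vfield \<Rightarrow> 'n vfield \<Rightarrow> 'n vfield" where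
  "levi_civita g = (SOME D. levi_civita_connection g D)"

definition curvature :: "'n::finite metric \<Rightarrow> 'n vfield \<Rightarrow> 'n vfield \<Rightarrow> 'n vfield \<Rightarrow> 'n vfield" where
  "curvature g X Y Z a =
     levi_civita g X (levi_civita g Y Z) a
     - levi_civita g Y (levi_civita g X Z) a
     - levi_civita g (lie_bracket X Y) Z a"

text \<open>
  The curvature is tensorial, so its value at \<open>a\<close> on tangent vectors \<open>u\<close>, \<open>v\<close>, \<open>w\<close> may be
  computed from any smooth extensions; the constant ones are used.
\<close>

definition curvature_op ::
    "'n::finite metric \<Rightarrow> real^'n \<Rightarrow> real^'n \<Rightarrow> real^'n \<Rightarrow> real^'n \<Rightarrow> real^'n" where
  "curvature_op g a u v w = curvature g (\<lambda>_. u) (\<lambda>_. v) (\<lambda>_. w) a"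

definition curvature_tensor ::
    "'n::finite metric \<Rightarrow> real^'n \<Rightarrow> real^'n \<Rightarrow> real^'n \<Rightarrow> real^'n \<Rightarrow> real^'n \<Rightarrow> real" where
  "curvature_tensor g a u v w t = g a (curvature_op g a u v w) t"

definition ricci :: "'n::finite metric \<Rightarrow> real^'n \<Rightarrow> real^'n \<Rightarrow> real^'n \<Rightarrow> real" where
  "ricci g a v w = trace (matrix (\<lambda>u. curvature_op g a u v w))"

definition ricci_flat :: "'n::finite metric \<Rightarrow> bool" where
  "ricci_flat g \<longleftrightarrow> (\<forall>a v w. ricci g a v w = 0)"

definition jacobi_op :: "'n::finite metric \<Rightarrow> real^'n \<Rightarrow> real^'n \<Rightarrow> real^'n \<Rightarrow> real^'n" where
  "jacobi_op g a u = (THE J. \<forall>v w. g a (J v) w = curvature_tensor g a v u u w)"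

definition complex_spectrum :: "(real^'n \<Rightarrow> real^'n::finite) \<Rightarrow> complex set" where
  "complex_spectrum T =
     {\<mu>. \<exists>v::complex^'n. v \<noteq> 0 \<and> (\<chi> i j. complex_of_real (matrix T $ i $ j)) *v v = \<mu> *s v}"

definition nilpotent_osserman :: "'n::finite metric \<Rightarrow> bool" where
  "nilpotent_osserman g \<longleftrightarrow> (\<forall>a u. complex_spectrum (jacobi_op g a u) = {0})"

text \<open>
  The non-degenerate oriented 2-planes are exactly the spans of the pairs below, ordered by the
  orientation.
\<close>

definition orthonormal_pair :: "'n::finite metric \<Rightarrow> real^'n \<Rightarrow> real^'n \<Rightarrow> real^'n \<Rightarrow> bool" where
  "orthonormal_pair g a u v \<longleftrightarrow> g a u v = 0 \<and> g a u u \<in> {1, -1} \<and> g a v v \<in> {1, -1}"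

definition nilpotent_ivanov_petrova :: "'n::finite metric \<Rightarrow> bool" where
  "nilpotent_ivanov_petrova g \<longleftrightarrow>
     (\<forall>a u v. orthonormal_pair g a u v \<longrightarrow> complex_spectrum (curvature_op g a u v) = {0})"


section \<open>The manifolds\<close>

text \<open>
  Coordinate labels: \<open>CX\<close>, \<open>CY\<close>, \<open>CZ k\<close> for \<open>x\<close>, \<open>y\<close>, \<open>z\<^sub>i\<close>, and \<open>CX'\<close>, \<open>CY'\<close>, \<open>CZ' k\<close> for
  their barred companions. The labels \<open>k\<close> of the \<open>z\<close>-coordinates range over a finite type, which
  an enumeration \<open>idx\<close> identifies with \<open>{0..p}\<close>.
\<close>

datatype 'k coord = CX | CY | CZ 'k | CX' | CY' | CZ' 'k

lemma UNIV_coord: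
  "(UNIV :: 'k coord set) = {CX, CY, CX', CY'} \<union> (range CZ \<union> range CZ')"
proof -
  have "c \<in> {CX, CY, CX', CY'} \<union> (range CZ \<union> range CZ')" for c :: "'k coord"
    by (cases c) auto
  then show ?thesis by blast
qed

instance coord :: (finite) finite
  by standard (simp add: UNIV_coord)

lemma CARD_coord: "CARD('k::finite coord) = 2 * CARD('k) + 4"
proof -
  have "CARD('k coord) = card {CX, CY, CX', CY' :: 'k coord} + card (range CZ \<union> range (CZ' :: 'k \<Rightarrow> _))"
    unfolding UNIV_coord by (rule card_Un_disjoint) auto
  also have "card (range CZ \<union> range (CZ' :: 'k \<Rightarrow> _)) = 2 * CARD('k)"
    by (subst card_Un_disjoint) (auto simp: card_image inj_def)
  finally show ?thesis by simp
qed

definition F_fun :: "(real \<Rightarrow> real) \<Rightarrow> ('k::finite \<Rightarrow> nat) \<Rightarrow> real^('k coord) \<Rightarrow> real" where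
  "F_fun f idx a = f (a $ CY) + (\<Sum>k\<in>UNIV. (a $ CY) ^ (idx k + 1) * a $ CZ k)"

definition g_metric :: "(real \<Rightarrow> real) \<Rightarrow> ('k::finite \<Rightarrow> nat) \<Rightarrow> 'k coord metric" where
  "g_metric f idx a u v =
     (\<Sum>k\<in>UNIV. u $ CZ k * v $ CZ' k + u $ CZ' k * v $ CZ k)
     + (u $ CX * v $ CX' + u $ CX' * v $ CX)
     + (u $ CY * v $ CY' + u $ CY' * v $ CY)
     - 2 * F_fun f idx a * (u $ CX * v $ CX)"


section \<open>Well-definedness: the metric is pseudo-Riemannian and has a Levi-Civita connection\<close>

lemma C_k_SucI:
  assumes "\<And>a. (f has_derivative f' a) (at a)" "\<And>v. C_k k (\<lambda>a. f' a v)"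
  shows "C_k (Suc k) f"
proof -
  have "frechet_derivative f (at a) = f' a" for a
    using assms(1) frechet_derivative_at by metis
  then show ?thesis using assms by (auto simp: differentiable_def)
qed

lemma C_k_SucD:
  assumes "C_k (Suc k) f"
  shows "(f has_derivative frechet_derivative f (at a)) (at a)" "C_k k (\<lambda>a. frechet_derivative f (at a) v)"
  using assms frechet_derivative_works by auto

lemma C_k_lower: "C_k (Suc k) f \<Longrightarrow> C_k k f"
proof (induction k arbitrary: f)
  case 0
  then show ?case
    by (simp add: continuous_on_eq_continuous_at differentiable_imp_continuous_within)
next
  case (Suc k)
  show ?case
    by (rule C_k_SucI[OF C_k_SucD(1)[OF Suc.prems] Suc.IH[OF C_k_SucD(2)[OF Suc.prems]]])
qed

lemma C_k_const: "C_k k (\<lambda>a. c)"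
proof (induction k arbitrary: c)
  case (Suc k) show ?case by (rule C_k_SucI[where f' = "\<lambda>_ _. 0"]) (auto simp: Suc)
qed simp

lemma C_k_linear: "bounded_linear f \<Longrightarrow> C_k k f"
proof (cases k)
  case 0 then show "bounded_linear f \<Longrightarrow> C_k k f" by (simp add: linear_continuous_on)
next
  case (Suc m) show "bounded_linear f \<Longrightarrow> C_k k f"
    unfolding Suc by (rule C_k_SucI[where f' = "\<lambda>_. f"]) (auto simp: C_k_const bounded_linear_imp_has_derivative)
qed

lemma C_k_add: "C_k k f \<Longrightarrow> C_k k g \<Longrightarrow> C_k k (\<lambda>a. f a + g a)"
proof (induction k arbitrary: f g)
  case 0 then show ?case by (simp add: continuous_on_add)
next
  case (Suc k) show ?case
    by (rule C_k_SucI[OF has_derivative_add[OF C_k_SucD(1)[OF Suc.prems(1)] C_k_SucD(1)[OF Suc.prems(2)]]], rule Suc.IH, rule C_k_SucD(2)[OF Suc.prems(1)], rule C_k_SucD(2)[OF Suc.prems(2)])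
qed

lemma C_k_sum: "(\<And>i. i \<in> I \<Longrightarrow> C_k k (f i)) \<Longrightarrow> C_k k (\<lambda>a. \<Sum>i\<in>I. f i a)"
  by (induction I rule: infinite_finite_induct) (auto simp: C_k_const intro!: C_k_add)

lemma C_k_bilinear:
  assumes "bounded_bilinear pr"
  shows "C_k k f \<Longrightarrow> C_k k g \<Longrightarrow> C_k k (\<lambda>a. pr (f a) (g a))"
proof (induction k arbitrary: f g)
  case 0 then show ?case
    by (simp add: bounded_bilinear.continuous_on[OF assms])
next
  case (Suc k)
  show ?case
  proof (rule C_k_SucI[OF bounded_bilinear.FDERIV[OF assms C_k_SucD(1)[OF Suc.prems(1)] C_k_SucD(1)[OF Suc.prems(2)]]])
    fix v
    have f: "C_k k f" "C_k k (\<lambda>a. frechet_derivative f (at a) v)" and g: "C_k k g" "C_k k (\<lambda>a. frechet_derivative g (at a) v)"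
      by (rule C_k_lower[OF Suc.prems(1)] C_k_SucD(2)[OF Suc.prems(1)] C_k_lower[OF Suc.prems(2)] C_k_SucD(2)[OF Suc.prems(2)])+
    show "C_k k (\<lambda>a. pr (f a) (frechet_derivative g (at a) v) + pr (frechet_derivative f (at a) v) (g a))"
      by (rule C_k_add[OF Suc.IH[OF f(1) g(2)] Suc.IH[OF f(2) g(1)]])
  qed
qed

lemma C_k_compose_linear:
  assumes "bounded_linear l"
  shows "C_k k f \<Longrightarrow> C_k k (\<lambda>a. f (l a))"
proof (induction k arbitrary: f)
  case 0 then show ?case
    using continuous_on_compose2[OF _ linear_continuous_on[OF assms]] by auto
next
  case (Suc k) show ?case
    by (rule C_k_SucI[OF has_derivative_compose[OF bounded_linear_imp_has_derivative[OF assms] C_k_SucD(1)[OF Suc.prems]]], rule Suc.IH, rule C_k_SucD(2)[OF Suc.prems])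
qed

lemmas C_k_mult = C_k_bilinear[OF bounded_bilinear_mult]
lemmas C_k_scaleR = C_k_bilinear[OF bounded_bilinear_scaleR]
lemma C_k_power: "C_k k (f:: 'a::real_normed_vector \<Rightarrow> real) \<Longrightarrow> C_k k (\<lambda>a. f a ^ n)"
  by (induction n) (auto intro!: C_k_mult C_k_const)

lemma C_k_linear_compose:
  assumes "bounded_linear l"
  shows "C_k k f \<Longrightarrow> C_k k (\<lambda>a. l (f a))"
proof (induction k arbitrary: f)
  case 0 then show ?case
    using bounded_linear.continuous_on[OF assms] by auto
next
  case (Suc k) show ?case
    by (rule C_k_SucI[OF bounded_linear.has_derivative[OF assms C_k_SucD(1)[OF Suc.prems]]], rule Suc.IH, rule C_k_SucD(2)[OF Suc.prems])
qed

lemma smooth_nth: "smooth X \<Longrightarrow> smooth (\<lambda>a. X a $ i)"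
  unfolding smooth_def by (auto intro: C_k_linear_compose bounded_linear_vec_nth)
lemma smooth_const: "smooth (\<lambda>a. c)" by (simp add: smooth_def C_k_const)
lemma smooth_add: "smooth f \<Longrightarrow> smooth g \<Longrightarrow> smooth (\<lambda>a. f a + g a)" by (simp add: smooth_def C_k_add)
lemma smooth_sum: "(\<And>i. i \<in> I \<Longrightarrow> smooth (f i)) \<Longrightarrow> smooth (\<lambda>a. \<Sum>i\<in>I. f i a)" by (simp add: smooth_def C_k_sum)
lemma smooth_mult: "smooth f \<Longrightarrow> smooth g \<Longrightarrow> smooth (\<lambda>a. f a * g a :: real)" by (simp add: smooth_def C_k_mult)
lemma smooth_scaleR: "smooth f \<Longrightarrow> smooth g \<Longrightarrow> smooth (\<lambda>a. f a *\<^sub>R g a)" by (simp add: smooth_def C_k_scaleR)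
lemma smooth_minus: "smooth (f::'a::real_normed_vector \<Rightarrow> 'b::real_normed_vector) \<Longrightarrow> smooth (\<lambda>a. - f a)"
  using smooth_scaleR[OF smooth_const[of "-1"], of f] by simp
lemma smooth_has_derivative: "smooth f \<Longrightarrow> (f has_derivative frechet_derivative f (at a)) (at a)"
  unfolding smooth_def using C_k_SucD(1) by metis
lemma smooth_directional_derivative: "smooth f \<Longrightarrow> smooth (\<lambda>a. frechet_derivative f (at a) v)"
  unfolding smooth_def using C_k_SucD(2) by metis

lemma smooth_frechet_derivative:
  fixes X :: "'n::finite vfield" and f :: "real^'n \<Rightarrow> 'b::real_normed_vector"
  assumes "smooth f" "smooth X"
  shows "smooth (\<lambda>a. frechet_derivative f (at a) (X a))"
proof -
  have "frechet_derivative f (at a) (X a) = (\<Sum>i\<in>UNIV. X a $ i *\<^sub>R frechet_derivative f (at a) (axis i 1))" for a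
  proof -
    have l: "linear (frechet_derivative f (at a))" using smooth_has_derivative[OF assms(1)] has_derivative_linear by blast
    show ?thesis
      by (subst basis_expansion[of "X a", symmetric])
         (simp add: linear_sum[OF l] linear_cmul[OF l] scalar_mult_eq_scaleR)
  qed
  then show ?thesis by (auto intro!: smooth_sum smooth_scaleR smooth_nth smooth_directional_derivative assms)
qed

lemma smooth_F: fixes idx :: "'b::finite \<Rightarrow> nat" shows "smooth f \<Longrightarrow> smooth (F_fun f idx)"
proof -
  assume s: "smooth f"
  have n: "C_k k (\<lambda>a::real^'b coord. a $ i)" for k and i :: "'b coord"
    by (rule C_k_linear[OF bounded_linear_vec_nth])
  have "C_k k (F_fun f idx)" for k
    unfolding F_fun_def[abs_def]
  proof (rule C_k_add)
    show "C_k k (\<lambda>a::real^'b coord. f (a $ CY))"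
      using C_k_compose_linear[OF bounded_linear_vec_nth] s unfolding smooth_def by blast
    show "C_k k (\<lambda>a::real^'b coord. \<Sum>j\<in>UNIV. (a $ CY) ^ (idx j + 1) * a $ CZ j)"
      by (rule C_k_sum, rule C_k_mult, rule C_k_power, rule n, rule n)
  qed
  then show ?thesis by (simp add: smooth_def)
qed

lemma sum_coord: "(\<Sum>i\<in>UNIV. h i) = h CX + h CY + h CX' + h CY' + (\<Sum>k\<in>UNIV. h (CZ k) + h (CZ' k))"
  for h :: "'k::finite coord \<Rightarrow> real"
proof -
  have "(\<Sum>i\<in>UNIV. h i) = sum h {CX, CY, CX', CY'} + (sum h (range CZ) + sum h (range CZ'))"
    unfolding UNIV_coord
    by (subst sum.union_disjoint, simp, simp, force) (subst sum.union_disjoint, auto)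
  then show ?thesis by (simp add: sum.reindex inj_def sum.distrib)
qed

lemma axis_nth: "axis i (1::real) $ j = of_bool (j = i)" by (simp add: axis_def)

lemma g_metric_axis:
  "g_metric f idx a u (axis (CZ' k) 1) = u $ CZ k"
  "g_metric f idx a u (axis (CX') 1) = u $ CX"
  "g_metric f idx a u (axis (CY') 1) = u $ CY"
  "g_metric f idx a u (axis (CY) 1) = u $ CY'"
  "g_metric f idx a u (axis (CZ k) 1) = u $ CZ' k"
  "g_metric f idx a u (axis (CX) 1) = u $ CX' - 2 * F_fun f idx a * u $ CX"
  by (simp_all add: g_metric_def axis_nth)

lemma bilinear_g_metric: "bilinear (g_metric f idx a)"
  unfolding bilinear_def g_metric_def
  by (auto intro!: linearI simp: algebra_simps sum.distrib sum_distrib_left)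

lemma pseudo_riemannian_g_metric:
  assumes "smooth f" shows "pseudo_riemannian_metric (g_metric f idx)"
  unfolding pseudo_riemannian_metric_def
proof (intro conjI allI impI bilinear_g_metric)
  fix a u v show "g_metric f idx a u v = g_metric f idx a v u"
    by (simp add: g_metric_def algebra_simps)
next
  fix a u assume h: "\<forall>v. g_metric f idx a u v = 0"
  have x: "u $ CX = 0" using h g_metric_axis(2) by metis
  have x': "u $ CX' = 0" using h g_metric_axis(6)[of f idx a u] x by simp
  show "u = 0"
  proof (subst vec_eq_iff, intro allI)
    fix i :: "'a coord" show "u $ i = 0 $ i"
      apply (cases i) using x x' h[rule_format, of "axis _ 1"] g_metric_axis[of f idx a u] by simp_all
  qed
next
  fix u v show "smooth (\<lambda>a. g_metric f idx a u v)"
    unfolding g_metric_def diff_conv_add_uminus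
    by (intro smooth_add smooth_const smooth_minus smooth_mult smooth_F assms)
qed

text \<open>\<open>\<nabla>\<^sub>u v\<close> at \<open>a\<close> for the constant fields \<open>u\<close>, \<open>v\<close>, when \<open>F\<close> is the function in \<open>g(\<partial>\<^sub>x, \<partial>\<^sub>x) = -2 F\<close>.\<close>

definition christoffel ::
    "(real^('k::finite coord) \<Rightarrow> real) \<Rightarrow> real^('k coord) \<Rightarrow> real^('k coord) \<Rightarrow> real^('k coord) \<Rightarrow> real^('k coord)" where
  "christoffel F a u v =
     (u $ CX * v $ CX) *\<^sub>R
       (frechet_derivative F (at a) (axis CY 1) *\<^sub>R axis CY' 1
        + (\<Sum>k\<in>UNIV. frechet_derivative F (at a) (axis (CZ k) 1) *\<^sub>R axis (CZ' k) 1))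
     + (- (frechet_derivative F (at a) u * v $ CX + frechet_derivative F (at a) v * u $ CX))
       *\<^sub>R axis CX' 1"

lemma levi_civita_connection_exists: fixes idx :: "'a::finite \<Rightarrow> nat" assumes "smooth f" shows "\<exists>D. levi_civita_connection (g_metric f idx) D"
proof -
  define F where "F = F_fun f idx"
  have sF: "smooth F" unfolding F_def by (rule smooth_F[OF assms])
  define dF where "dF a = frechet_derivative F (at a)" for a
  have ldF: "linear (dF a)" for a unfolding dF_def using smooth_has_derivative[OF sF] has_derivative_linear by blast
  have dep: "F b = F c" if "b $ CY = c $ CY" "\<And>k. b $ CZ k = c $ CZ k" for b c
    unfolding F_def F_fun_def using that by simp
  have z: "dF a w = 0" if "w $ CY = 0" "\<And>k. w $ CZ k = 0" for a w
  proof -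
    have 1: "((\<lambda>t::real. F (a + t *\<^sub>R w)) has_derivative (\<lambda>t. dF a (t *\<^sub>R w))) (at 0)"
      by (rule has_derivative_compose[of "\<lambda>t. a + t *\<^sub>R w"])
         (auto intro!: derivative_eq_intros simp: dF_def smooth_has_derivative[OF sF])
    have "(\<lambda>t::real. F (a + t *\<^sub>R w)) = (\<lambda>t. F a)"
      by (rule ext, rule dep) (auto simp: that)
    then have "((\<lambda>t::real. F (a + t *\<^sub>R w)) has_derivative (\<lambda>t. 0)) (at 0)" by simp
    with 1 have "(\<lambda>t. dF a (t *\<^sub>R w)) = (\<lambda>t. 0)" by (rule has_derivative_unique)
    from fun_cong[OF this, of 1] show ?thesis by simp
  qed
  have dF_expand: "dF a w = dF a (axis CY 1) * w $ CY + (\<Sum>k\<in>UNIV. dF a (axis (CZ k) 1) * w $ CZ k)" for a w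
  proof -
    have "dF a w = (\<Sum>i\<in>UNIV. w $ i * dF a (axis i 1))"
      by (subst basis_expansion[of w, symmetric])
         (simp add: linear_sum[OF ldF] linear_cmul[OF ldF] scalar_mult_eq_scaleR)
    also have "\<dots> = dF a (axis CY 1) * w $ CY + (\<Sum>k\<in>UNIV. dF a (axis (CZ k) 1) * w $ CZ k)"
    proof -
      have "dF a (axis CX 1) = 0" "dF a (axis CX' 1) = 0" "dF a (axis CY' 1) = 0"  "\<And>k. dF a (axis (CZ' k) 1) = 0" 
        by (auto intro!: z simp: axis_def)
      then show ?thesis unfolding sum_coord by (simp add: mult.commute)
    qed
    finally show ?thesis .
  qed
  let ?g = "g_metric f idx"
  have g_ch: "?g a (christoffel F a u v) w = u $ CX * v $ CX * dF a w - (dF a u * v $ CX + dF a v * u $ CX) * w $ CX" for a u v w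
    unfolding christoffel_def dF_def[symmetric]
    by (subst dF_expand[of a w]) (simp add: g_metric_def axis_nth algebra_simps sum_distrib_left sum.distrib)
  have gsym: "?g a u v = ?g a v u" for a u v by (simp add: g_metric_def algebra_simps)
  define D where "D X Y a = frechet_derivative Y (at a) (X a) + christoffel F a (X a) (Y a)" for X Y a
  have lin: "linear (frechet_derivative h (at a))" if "smooth h" for h :: "real^'a coord \<Rightarrow> real^'a coord" and a
    using smooth_has_derivative[OF that] has_derivative_linear by blast
  have ch_lin: "christoffel F a u (v + v') = christoffel F a u v + christoffel F a u v'"
            "christoffel F a (u + u') v = christoffel F a u v + christoffel F a u' v"
            "christoffel F a (c *\<^sub>R u) v = c *\<^sub>R christoffel F a u v"
            "christoffel F a u (c *\<^sub>R v) = c *\<^sub>R christoffel F a u v" for a u u' v v' c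
    unfolding christoffel_def dF_def[symmetric]
    by (simp_all add: linear_add[OF ldF] linear_cmul[OF ldF] algebra_simps)
  have fd: "frechet_derivative h (at a) = h'" if "(h has_derivative h') (at a)" for h :: "real^'a coord \<Rightarrow> real^'a coord" and h' a
    using frechet_derivative_at that by metis
  have 1: "affine_connection D"
    unfolding affine_connection_def
  proof (intro conjI allI impI)
    fix X Y :: "'a coord vfield" assume "smooth X" "smooth Y"
    then show "smooth (D X Y)"
      unfolding D_def[abs_def] christoffel_def
      by (intro smooth_add smooth_frechet_derivative smooth_scaleR smooth_mult smooth_sum smooth_minus smooth_nth smooth_const smooth_directional_derivative sF)
  next
    fix X X' Y :: "'a coord vfield" and a assume "smooth X" "smooth X'" "smooth Y"
    then show "D (\<lambda>b. X b + X' b) Y a = D X Y a + D X' Y a"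
      by (simp add: D_def ch_lin linear_add[OF lin])
  next
    fix \<phi> :: "real^'a coord \<Rightarrow> real" and X Y :: "'a coord vfield" and a assume "smooth \<phi>" "smooth X" "smooth Y"
    then show "D (\<lambda>b. \<phi> b *\<^sub>R X b) Y a = \<phi> a *\<^sub>R D X Y a"
      by (simp add: D_def ch_lin linear_cmul[OF lin] algebra_simps)
  next
    fix X Y Y' :: "'a coord vfield" and a assume "smooth X" "smooth Y" "smooth Y'"
    then show "D X (\<lambda>b. Y b + Y' b) a = D X Y a + D X Y' a"
      by (simp add: D_def ch_lin fd[OF has_derivative_add[OF smooth_has_derivative smooth_has_derivative]])
  next
    fix \<phi> :: "real^'a coord \<Rightarrow> real" and X Y :: "'a coord vfield" and a assume "smooth \<phi>" "smooth X" "smooth Y"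
    then show "D X (\<lambda>b. \<phi> b *\<^sub>R Y b) a = lie_derivative X \<phi> a *\<^sub>R Y a + \<phi> a *\<^sub>R D X Y a"
      by (simp add: D_def ch_lin lie_derivative_def fd[OF has_derivative_scaleR[OF smooth_has_derivative smooth_has_derivative]] algebra_simps)
  qed
  have "levi_civita_connection ?g D"
    unfolding levi_civita_connection_def
  proof (intro conjI allI impI 1)
    fix X Y :: "'a coord vfield" and a 
    show "D X Y a - D Y X a = lie_bracket X Y a"
      by (simp add: D_def lie_bracket_def christoffel_def algebra_simps)
  next
    fix X Y Z :: "'a coord vfield" and a assume s: "smooth X" "smooth Y" "smooth Z"
    note nd = bounded_linear.has_derivative[OF bounded_linear_vec_nth smooth_has_derivative]
    define u where "u = X a"
    define Y' where "Y' = frechet_derivative Y (at a) u"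
    define Z' where "Z' = frechet_derivative Z (at a) u"
    have "((\<lambda>b. ?g b (Y b) (Z b)) has_derivative (\<lambda>u. ?g a (frechet_derivative Y (at a) u) (Z a) + ?g a (Y a) (frechet_derivative Z (at a) u) - 2 * dF a u * (Y a $ CX * Z a $ CX))) (at a)"
      unfolding g_metric_def F_def[symmetric] dF_def
      apply (rule has_derivative_eq_rhs)
       apply (rule derivative_intros nd s smooth_has_derivative sF)+
      by (auto simp: algebra_simps sum.distrib sum_distrib_left)
    from frechet_derivative_at[OF this, symmetric] have "lie_derivative X (\<lambda>b. ?g b (Y b) (Z b)) a = ?g a Y' (Z a) + ?g a (Y a) Z' - 2 * dF a u * (Y a $ CX * Z a $ CX)"
      by (simp add: lie_derivative_def Y'_def Z'_def u_def)
    moreover have "?g a (D X Y a) (Z a) = ?g a Y' (Z a) + ?g a (christoffel F a u (Y a)) (Z a)"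
      unfolding D_def Y'_def u_def using bilinear_ladd[OF bilinear_g_metric] by blast
    moreover have "?g a (Y a) (D X Z a) = ?g a (Y a) Z' + ?g a (christoffel F a u (Z a)) (Y a)"
      unfolding D_def Z'_def u_def using bilinear_radd[OF bilinear_g_metric] gsym by metis
    ultimately show "lie_derivative X (\<lambda>b. ?g b (Y b) (Z b)) a = ?g a (D X Y a) (Z a) + ?g a (Y a) (D X Z a)"
      unfolding g_ch by (simp add: algebra_simps)
  qed
  then show ?thesis by blast
qed

end

theory Submission
  imports Defs
begin

text \<open>
  Call the coordinates \<open>x\<close>, \<open>y\<close>, \<open>z\<^sub>i\<close> unbarred, and let \<open>N\<close> be the span of the coordinate fields of
  the barred ones. The subspace \<open>N\<close> equals its own orthogonal complement, and the only non-constant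
  coefficient of the metric, \<open>g(\<partial>\<^sub>x, \<partial>\<^sub>x) = -2 F\<close>, pairs unbarred fields only and does not depend on
  the barred coordinates. The Christoffel symbol \<open>\<Gamma>(v, w) = \<nabla>\<^sub>v w\<close> of constant fields therefore
  takes its values in \<open>N\<close>, vanishes as soon as \<open>v\<close> or \<open>w\<close> lies in \<open>N\<close>, and is constant along \<open>N\<close>
  (\<open>christoffel_in_barred\<close>, \<open>christoffel_eq_0\<close>, \<open>christoffel_translate\<close>). Hence the quadratic terms
  \<open>\<Gamma>(u, \<Gamma>(v, w))\<close> of the curvature disappear, and
  \<open>\<R>(u, v) w = \<partial>\<^sub>u \<Gamma>(v, w) - \<partial>\<^sub>v \<Gamma>(u, w)\<close> (\<open>curvature_op_eq\<close>).

  The three properties of \<open>\<Gamma>\<close> are inherited by \<open>\<R>\<close>: it is \<open>N\<close>-valued, and it vanishes if one of its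
  three arguments lies in \<open>N\<close>. So each of the three endomorphisms in question, namely
  \<open>u \<mapsto> \<R>(u, v) w\<close> for the Ricci tensor, \<open>v \<mapsto> \<R>(v, u) u\<close> for the Jacobi operator, and
  \<open>w \<mapsto> \<R>(u, v) w\<close>, maps the whole space into \<open>N\<close> and \<open>N\<close> to zero. Its matrix has a single
  off-diagonal block, so its trace is zero and its only eigenvalue is zero.

  The Levi-Civita connection is a chosen one, so \<open>\<nabla>\<close> is accessible only through
  its defining properties; Koszul's formula turns them into the value
  \<open>\<nabla>\<^sub>X Y = dY(X) + \<Gamma>(X, Y)\<close> (\<open>levi_civita_g_metric\<close>).
\<close>

section \<open>Endomorphisms with a single off-diagonal block\<close>

definition coord_subspace :: "'n set \<Rightarrow> (real^'n) set" where
  "coord_subspace S = {u. \<forall>i. i \<notin> S \<longrightarrow> u $ i = 0}"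

lemma axis_in_coord_subspace: "i \<in> S \<Longrightarrow> axis i c \<in> coord_subspace S"
  by (auto simp: coord_subspace_def axis_def)

lemma matrix_block:
  assumes "\<And>v. T v \<in> coord_subspace S" "\<And>v. v \<in> coord_subspace S \<Longrightarrow> T v = 0"
    and "i \<notin> S \<or> j \<in> S"
  shows "matrix T $ i $ j = 0"
  using assms(1)[of "axis j 1"] assms(2)[OF axis_in_coord_subspace[of j S 1]] assms(3)
  by (auto simp: matrix_def coord_subspace_def)

lemma trace_block:
  assumes "\<And>v. T v \<in> coord_subspace S" "\<And>v. v \<in> coord_subspace S \<Longrightarrow> T v = 0"
  shows "trace (matrix T) = 0"
  unfolding trace_def using matrix_block[of T S, OF assms] by (intro sum.neutral) auto

text \<open>
  Such an endomorphism squares to zero, which leaves zero as the only possible eigenvalue. It is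
  attained, since a coordinate vector of an index in \<open>S\<close> lies in the kernel.
\<close>

lemma complex_spectrum_block:
  assumes T: "\<And>v. T v \<in> coord_subspace S" "\<And>v. v \<in> coord_subspace S \<Longrightarrow> T v = 0"
    and "S \<noteq> {}"
  shows "complex_spectrum T = {0}"
proof (rule set_eqI)
  fix \<mu> :: complex
  define M where "M = (\<chi> i j. complex_of_real (matrix T $ i $ j))"
  have M0: "M $ i $ j = 0" if "i \<notin> S \<or> j \<in> S" for i j
    using matrix_block[of T S, OF T that] by (simp add: M_def)
  have "\<mu> = 0" if "v \<noteq> 0" and v: "M *v v = \<mu> *s v" for v
  proof (rule ccontr)
    assume \<mu>: "\<mu> \<noteq> 0"
    have comp: "(\<Sum>j\<in>UNIV. M $ i $ j * v $ j) = \<mu> * v $ i" for i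
      using arg_cong[OF v, of "\<lambda>w. w $ i"] by (simp add: matrix_vector_mult_def)
    have "v $ i = 0" if "i \<notin> S" for i
      using comp[of i] \<mu> that by (simp add: M0)
    then have vanish: "M $ i $ j * v $ j = 0" for i j
      using M0 by (cases "j \<in> S") auto
    have "v $ i = 0" for i
      using comp[of i, unfolded vanish] \<mu> by simp
    then show False using \<open>v \<noteq> 0\<close> by (simp add: vec_eq_iff)
  qed
  moreover have "\<exists>v. v \<noteq> 0 \<and> M *v v = 0 *s v"
  proof -
    obtain s where s: "s \<in> S" using \<open>S \<noteq> {}\<close> by blast
    have "M *v axis s 1 = 0"
      using s by (auto simp: vec_eq_iff matrix_vector_mult_def axis_def M0 intro!: sum.neutral)
    then show ?thesis by (intro exI[of _ "axis s 1"]) (simp add: axis_eq_0_iff)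
  qed
  ultimately show "\<mu> \<in> complex_spectrum T \<longleftrightarrow> \<mu> \<in> {0}"
    unfolding complex_spectrum_def M_def[symmetric] by auto
qed


section \<open>Koszul's formula\<close>

text \<open>
  Rewriting brackets by the absence of torsion and derivatives of the metric by its compatibility
  with \<open>D\<close>, all terms on the right cancel in pairs except two copies of \<open>g(D\<^sub>X Y, Z)\<close>.
\<close>

lemma koszul:
  assumes g: "pseudo_riemannian_metric g" and D: "levi_civita_connection g D"
    and s: "smooth X" "smooth Y" "smooth Z"
  shows "2 * g a (D X Y a) (Z a) =
    lie_derivative X (\<lambda>b. g b (Y b) (Z b)) a + lie_derivative Y (\<lambda>b. g b (Z b) (X b)) a
    - lie_derivative Z (\<lambda>b. g b (X b) (Y b)) a
    + g a (lie_bracket X Y a) (Z a) - g a (lie_bracket X Z a) (Y a)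
    - g a (lie_bracket Y Z a) (X a)"
proof -
  have bil: "bilinear (g a)" and sym: "g a u v = g a v u" for u v
    using g by (auto simp: pseudo_riemannian_metric_def)
  have torsion: "lie_bracket V W a = D V W a - D W V a" if "smooth V" "smooth W" for V W
    using D that by (simp add: levi_civita_connection_def)
  have compat: "lie_derivative V (\<lambda>b. g b (W b) (W' b)) a
      = g a (D V W a) (W' a) + g a (D V W' a) (W a)" if "smooth V" "smooth W" "smooth W'" for V W W'
    using D that sym[of "W a"] by (simp add: levi_civita_connection_def)
  show ?thesis
    by (simp add: torsion compat s bilinear_lsub[OF bil])
qed


section \<open>The Levi-Civita connection of the metric\<close>

definition barred :: "'k coord set" where
  "barred = {CX', CY'} \<union> range CZ'"

lemma barred_simps [simp]:
  "CX' \<in> barred" "CY' \<in> barred" "CZ' k \<in> barred" "CX \<notin> barred" "CY \<notin> barred" "CZ k \<notin> barred"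
  by (auto simp: barred_def)

lemma coord_subspace_barred_iff:
  "u \<in> coord_subspace barred \<longleftrightarrow> u $ CX = 0 \<and> u $ CY = 0 \<and> (\<forall>k. u $ CZ k = 0)"
proof
  assume h: "u $ CX = 0 \<and> u $ CY = 0 \<and> (\<forall>k. u $ CZ k = 0)"
  have "u $ i = 0" if "i \<notin> barred" for i using that h by (cases i) auto
  then show "u \<in> coord_subspace barred" by (simp add: coord_subspace_def)
qed (simp add: coord_subspace_def)

text \<open>
  The form in which independence of a coordinate enters, both for \<open>F\<close> and for the Christoffel
  symbol: only the line through \<open>a\<close> in the direction \<open>w\<close> has to be inspected.
\<close>

lemma frechet_derivative_eq_0:
  assumes "h differentiable (at a)" "\<And>t. h (a + t *\<^sub>R w) = h a"
  shows "frechet_derivative h (at a) w = 0"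
proof -
  have line: "((\<lambda>t. a + t *\<^sub>R w) has_derivative (\<lambda>t. t *\<^sub>R w)) (at 0)"
    by (auto intro!: derivative_eq_intros)
  have "(h has_derivative frechet_derivative h (at a)) (at (a + 0 *\<^sub>R w))"
    using assms(1) by (simp add: frechet_derivative_works[symmetric])
  from has_derivative_compose[OF line this]
  have "((\<lambda>t. h (a + t *\<^sub>R w)) has_derivative (\<lambda>t. frechet_derivative h (at a) (t *\<^sub>R w))) (at 0)" .
  moreover have "((\<lambda>t. h (a + t *\<^sub>R w)) has_derivative (\<lambda>t. 0)) (at 0)"
    by (simp add: assms(2))
  ultimately have "(\<lambda>t. frechet_derivative h (at a) (t *\<^sub>R w)) = (\<lambda>t. 0)"
    by (rule has_derivative_unique)
  from fun_cong[OF this, of 1] show ?thesis by simp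
qed

lemma smooth_differentiable: "smooth h \<Longrightarrow> h differentiable (at a)"
  using smooth_has_derivative differentiable_def by blast

context
  fixes f :: "real \<Rightarrow> real" and idx :: "'k::finite \<Rightarrow> nat"
  assumes smooth_f: "smooth f"
begin

private abbreviation (input) "F \<equiv> F_fun f idx"
private abbreviation (input) "dF \<equiv> \<lambda>a. frechet_derivative F (at a)"
private abbreviation (input) "g \<equiv> g_metric f idx"
private abbreviation (input) "\<Gamma> \<equiv> christoffel F"
private abbreviation (input) "N \<equiv> coord_subspace (barred :: 'k coord set)"

lemma linear_dF: "linear (dF a)"
  using smooth_has_derivative[OF smooth_F[OF smooth_f]] has_derivative_linear by blast

lemma F_translate: "n \<in> N \<Longrightarrow> F (a + n) = F a"
  by (simp add: F_fun_def coord_subspace_barred_iff)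

lemma dF_barred: "n \<in> N \<Longrightarrow> dF a n = 0"
  by (rule frechet_derivative_eq_0[OF smooth_differentiable[OF smooth_F[OF smooth_f]]])
     (rule F_translate, simp add: coord_subspace_barred_iff)

lemma dF_translate:
  assumes "n \<in> N" shows "dF (a + n) = dF a"
proof -
  have shift: "((\<lambda>b. b + n) has_derivative (\<lambda>h. h)) (at a)"
    by (auto intro!: derivative_eq_intros)
  have "((\<lambda>b. F (b + n)) has_derivative dF (a + n)) (at a)"
    by (rule has_derivative_compose[OF shift smooth_has_derivative[OF smooth_F[OF smooth_f]]])
  then have "(F has_derivative dF (a + n)) (at a)"
    by (simp add: F_translate[OF assms])
  then show ?thesis by (rule frechet_derivative_at)
qed

lemma dF_expand:
  "dF a w = dF a (axis CY 1) * w $ CY + (\<Sum>k\<in>UNIV. dF a (axis (CZ k) 1) * w $ CZ k)"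
proof -
  define w' :: "real^'k coord" where "w' = w $ CY *\<^sub>R axis CY 1 + (\<Sum>k\<in>UNIV. w $ CZ k *\<^sub>R axis (CZ k) 1)"
  \<comment> \<open>\<open>w - w'\<close> has only \<open>x\<close>- and barred components, and \<open>F\<close> depends on none of these coordinates.\<close>
  have "dF a (w - w') = 0"
    by (rule frechet_derivative_eq_0[OF smooth_differentiable[OF smooth_F[OF smooth_f]]])
       (simp add: F_fun_def w'_def axis_nth)
  then have "dF a w = dF a w'" by (simp add: linear_diff[OF linear_dF])
  then show ?thesis
    by (simp add: w'_def linear_add[OF linear_dF] linear_sum[OF linear_dF]
        linear_cmul[OF linear_dF] mult.commute)
qed

text \<open>
  The right-hand side is what Koszul's formula gives for \<open>g(\<nabla>\<^sub>u v, w)\<close> with constant \<open>u\<close>, \<open>v\<close>, \<open>w\<close>.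
\<close>

lemma g_christoffel:
  "g a (\<Gamma> a u v) w
    = u $ CX * v $ CX * dF a w - (dF a u * v $ CX + dF a v * u $ CX) * w $ CX"
  unfolding christoffel_def
  by (subst dF_expand[of a w])
     (simp add: g_metric_def axis_nth algebra_simps sum_distrib_left sum.distrib)

lemma lie_derivative_g:
  assumes s: "smooth Y" "smooth Z"
  shows "lie_derivative X (\<lambda>b. g b (Y b) (Z b)) a
    = g a (frechet_derivative Y (at a) (X a)) (Z a) + g a (frechet_derivative Z (at a) (X a)) (Y a)
      - 2 * dF a (X a) * (Y a $ CX * Z a $ CX)"
proof -
  note nd = bounded_linear.has_derivative[OF bounded_linear_vec_nth smooth_has_derivative]
  have "((\<lambda>b. g b (Y b) (Z b)) has_derivative
      (\<lambda>u. g a (frechet_derivative Y (at a) u) (Z a) + g a (frechet_derivative Z (at a) u) (Y a)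
        - 2 * dF a u * (Y a $ CX * Z a $ CX))) (at a)"
    unfolding g_metric_def
    apply (rule has_derivative_eq_rhs)
     apply (rule derivative_intros nd s smooth_has_derivative smooth_F smooth_f)+
    by (auto simp: algebra_simps sum.distrib sum_distrib_left)
  from frechet_derivative_at[OF this, symmetric] show ?thesis
    by (simp add: lie_derivative_def)
qed

text \<open>
  Koszul's formula determines \<open>g(\<nabla>\<^sub>X Y, w)\<close> for every constant field \<open>w\<close>, which suffices because
  the metric is non-degenerate.
\<close>

lemma levi_civita_g_metric:
  assumes s: "smooth X" "smooth Y"
  shows "levi_civita g X Y a = frechet_derivative Y (at a) (X a) + \<Gamma> a (X a) (Y a)"
proof -
  have g: "pseudo_riemannian_metric g" by (rule pseudo_riemannian_g_metric[OF smooth_f])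
  have D: "levi_civita_connection g (levi_civita g)"
    unfolding levi_civita_def by (rule someI_ex[OF levi_civita_connection_exists[OF smooth_f]])
  have sym: "g a u v = g a v u" for u v using g by (simp add: pseudo_riemannian_metric_def)
  note bil = bilinear_g_metric[of f idx a]
  let ?Z = "frechet_derivative Y (at a) (X a) + \<Gamma> a (X a) (Y a)"
  have "g a (levi_civita g X Y a - ?Z) w = 0" for w
  proof -
    have "2 * g a (levi_civita g X Y a) w = 2 * g a ?Z w"
      using koszul[OF g D s smooth_const[of w], of a]
      by (simp add: lie_derivative_g s smooth_const lie_bracket_def bilinear_ladd[OF bil]
          bilinear_lsub[OF bil] bilinear_lneg[OF bil] bilinear_lzero[OF bil] g_christoffel
          sym[of w] algebra_simps)
    then show ?thesis by (simp add: bilinear_lsub[OF bil])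
  qed
  then have "levi_civita g X Y a - ?Z = 0"
    using g unfolding pseudo_riemannian_metric_def by blast
  then show ?thesis by simp
qed


section \<open>The curvature\<close>

lemma christoffel_in_barred: "\<Gamma> a v w \<in> N"
  by (simp add: coord_subspace_barred_iff christoffel_def axis_nth)

lemma christoffel_eq_0: "v \<in> N \<or> w \<in> N \<Longrightarrow> \<Gamma> a v w = 0"
  using dF_barred[of v a] dF_barred[of w a]
  by (auto simp: coord_subspace_barred_iff christoffel_def)

lemma christoffel_translate: "n \<in> N \<Longrightarrow> \<Gamma> (a + n) v w = \<Gamma> a v w"
  by (simp add: christoffel_def dF_translate)

lemma smooth_christoffel: "smooth (\<lambda>a. \<Gamma> a v w)"
  unfolding christoffel_def
  by (intro smooth_add smooth_scaleR smooth_mult smooth_sum smooth_minus smooth_const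
      smooth_directional_derivative smooth_F smooth_f)

definition d\<Gamma> :: "real^'k coord \<Rightarrow> real^'k coord \<Rightarrow> real^'k coord \<Rightarrow> real^'k coord \<Rightarrow> real^'k coord"
  where "d\<Gamma> a u v w = frechet_derivative (\<lambda>b. \<Gamma> b v w) (at a) u"

lemma d\<Gamma>_in_barred: "d\<Gamma> a u v w \<in> N"
proof -
  have "d\<Gamma> a u v w $ i = 0" if "i \<notin> barred" for i
  proof -
    have "((\<lambda>b. \<Gamma> b v w $ i) has_derivative (\<lambda>u. d\<Gamma> a u v w $ i)) (at a)"
      unfolding d\<Gamma>_def
      by (rule bounded_linear.has_derivative[OF bounded_linear_vec_nth
            smooth_has_derivative[OF smooth_christoffel]])
    moreover have "(\<lambda>b. \<Gamma> b v w $ i) = (\<lambda>b. 0)"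
      using christoffel_in_barred that by (auto simp: coord_subspace_def)
    ultimately have "((\<lambda>b. 0) has_derivative (\<lambda>u. d\<Gamma> a u v w $ i)) (at a)" by simp
    then have "(\<lambda>u. d\<Gamma> a u v w $ i) = (\<lambda>u. 0)"
      by (rule has_derivative_unique) simp
    then show ?thesis by meson
  qed
  then show ?thesis by (simp add: coord_subspace_def)
qed

text \<open>
  In the first argument the reason is that \<open>\<Gamma>\<close> is constant along \<open>N\<close>; in the other two, the
  differentiated field is itself zero.
\<close>

lemma d\<Gamma>_eq_0: "u \<in> N \<or> v \<in> N \<or> w \<in> N \<Longrightarrow> d\<Gamma> a u v w = 0"
  unfolding d\<Gamma>_def
proof (elim disjE)
  assume u: "u \<in> N"
  then have "t *\<^sub>R u \<in> N" for t by (simp add: coord_subspace_def)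
  then show "frechet_derivative (\<lambda>b. \<Gamma> b v w) (at a) u = 0"
    by (intro frechet_derivative_eq_0 smooth_differentiable smooth_christoffel christoffel_translate)
qed (simp_all add: christoffel_eq_0)

text \<open>
  Differentiating the \<open>N\<close>-valued field \<open>\<nabla>\<^sub>v w = \<Gamma>(v, w)\<close> covariantly amounts to differentiating it
  componentwise, since \<open>\<Gamma>\<close> vanishes on \<open>N\<close>; the bracket of constant fields is zero.
\<close>

lemma curvature_op_eq: "curvature_op g a u v w = d\<Gamma> a u v w - d\<Gamma> a v u w"
proof -
  have const: "levi_civita g (\<lambda>_. s) (\<lambda>_. w) = (\<lambda>b. \<Gamma> b s w)" for s
    by (rule ext) (simp add: levi_civita_g_metric smooth_const)
  have "levi_civita g (\<lambda>_. s) (\<lambda>b. \<Gamma> b t w) a = d\<Gamma> a s t w" for s t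
    by (simp add: levi_civita_g_metric smooth_const smooth_christoffel d\<Gamma>_def
        christoffel_eq_0 christoffel_in_barred)
  moreover have "lie_bracket (\<lambda>_. u) (\<lambda>_. v) = (\<lambda>_. 0)"
    by (simp add: lie_bracket_def fun_eq_iff)
  moreover have "\<Gamma> a 0 w = 0"
    by (rule christoffel_eq_0) (simp add: coord_subspace_def)
  ultimately show ?thesis
    by (simp add: curvature_op_def curvature_def const)
qed

lemma curvature_op_in_barred: "curvature_op g a u v w \<in> N"
  using d\<Gamma>_in_barred[of a u v w] d\<Gamma>_in_barred[of a v u w]
  by (simp add: curvature_op_eq coord_subspace_def)

lemma curvature_op_eq_0: "u \<in> N \<or> v \<in> N \<or> w \<in> N \<Longrightarrow> curvature_op g a u v w = 0"
  by (auto simp: curvature_op_eq d\<Gamma>_eq_0)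

text \<open>
  Non-degeneracy of the metric makes the operator characterised by \<open>g(J v, w) = R(v, u, u, w)\<close>
  unique.
\<close>

lemma jacobi_op_eq: "jacobi_op g a u = (\<lambda>v. curvature_op g a v u u)"
  unfolding jacobi_op_def
proof (rule the_equality)
  fix J assume J: "\<forall>v w. g a (J v) w = curvature_tensor g a v u u w"
  have "J v - curvature_op g a v u u = 0" for v
  proof -
    have "g a (J v - curvature_op g a v u u) w = 0" for w
      using J by (simp add: bilinear_lsub[OF bilinear_g_metric] curvature_tensor_def)
    then show ?thesis
      using pseudo_riemannian_g_metric[OF smooth_f] unfolding pseudo_riemannian_metric_def by blast
  qed
  then show "J = (\<lambda>v. curvature_op g a v u u)" by auto
qed (simp add: curvature_tensor_def)

lemma ricci_flat_g_metric: "ricci_flat g"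
  unfolding ricci_flat_def ricci_def
  by (intro allI trace_block[of _ barred] curvature_op_in_barred curvature_op_eq_0) simp

lemma nilpotent_osserman_g_metric: "nilpotent_osserman g"
  unfolding nilpotent_osserman_def jacobi_op_eq
  by (intro allI complex_spectrum_block[of _ barred] curvature_op_in_barred curvature_op_eq_0)
     (auto simp: barred_def)

lemma nilpotent_ivanov_petrova_g_metric: "nilpotent_ivanov_petrova g"
  unfolding nilpotent_ivanov_petrova_def
  by (intro allI impI complex_spectrum_block[of _ barred] curvature_op_in_barred curvature_op_eq_0)
     (auto simp: barred_def)

end

theorem theorem1p5:
  fixes p :: nat and idx :: "'k::finite \<Rightarrow> nat" and f :: "real \<Rightarrow> real"
  assumes "bij_betw idx UNIV {0..p}" and "smooth f"
  shows "ricci_flat (g_metric f idx)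
    \<and> nilpotent_osserman (g_metric f idx)
    \<and> nilpotent_ivanov_petrova (g_metric f idx)"
  using ricci_flat_g_metric nilpotent_osserman_g_metric nilpotent_ivanov_petrova_g_metric assms(2)
  by blast

end
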